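(* Let $V$ be the set of pairs $(\Gamma,\phi)$ where $\Gamma$ is a finite s-theory, $\phi$ is an s-formula, and $\phi$ is a strict consequence of $\Gamma$. Then, under a standard Gödel numbering of formulas and finite sets of formulas, the set $V$ is computable.
   Context: Fix a countably infinite set $\Sigma=\{X_0,X_1,\dots\}$ of propositional variables, with a fixed enumeration used for the Gödel numbering. Propositional formulas are built from $\Sigma$ using $\lnot$, $\land$, $\lor$, $\to$. An s-formula is an expression of the form $A \prec B$ (a strict implication) or $A \not\prec B$ (a strict nonimplication), where $A$ and $B$ are propositional formulas; $\prec$ and $\not\prec$ are two formal symbols, not nested. An s-theory is a set of s-formulas. A valuation is a function $w:\Sigma\to\{T,F\}$, extended in the usual way to all propositional formulas. A frame is a nonempty set of valuations. A frame $R$ satisfies $A \prec B$ if for every $w\in R$, $w(A)=F$ or $w(B)=T$. A frame $R$ satisfies $A\not\prec B$ if there is some $w\in R$ with $w(A)=T$ and $w(B)=F$. A frame satisfies an s-theory if it satisfies every member. An s-formula $\phi$ is a strict consequence of an s-theory $\Gamma$ if every frame that satisfies $\Gamma$ satisfies $\phi$. *)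

theory Defs
  imports "HOL-Library.Nat_Bijection"
begin

section \<open>Propositional formulas, s-formulas and strict consequence\<close>

datatype form =
    Var nat
  | Neg form
  | Conj form form
  | Disj form form
  | Impl form form

text \<open>\<^term>\<open>StrictImp A B\<close> is \<open>A \<prec> B\<close>; \<^term>\<open>StrictNonimp A B\<close> is the formal nonimplication
  of \<open>B\<close> by \<open>A\<close>, a primitive symbol rather than a negation.\<close>

datatype sform =
    StrictImp form form
  | StrictNonimp form form

type_synonym stheory = "sform set"

type_synonym valuation = "nat \<Rightarrow> bool"

primrec val :: "valuation \<Rightarrow> form \<Rightarrow> bool" where
  "val w (Var i) = w i"
| "val w (Neg A) = (\<not> val w A)"
| "val w (Conj A B) = (val w A \<and> val w B)"
| "val w (Disj A B) = (val w A \<or> val w B)"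
| "val w (Impl A B) = (val w A \<longrightarrow> val w B)"

definition frame :: "valuation set \<Rightarrow> bool" where
  "frame R \<longleftrightarrow> R \<noteq> {}"

primrec satisfies :: "valuation set \<Rightarrow> sform \<Rightarrow> bool" where
  "satisfies R (StrictImp A B) = (\<forall>w\<in>R. \<not> val w A \<or> val w B)"
| "satisfies R (StrictNonimp A B) = (\<exists>w\<in>R. val w A \<and> \<not> val w B)"

definition satisfies_theory :: "valuation set \<Rightarrow> stheory \<Rightarrow> bool" where
  "satisfies_theory R \<Gamma> \<longleftrightarrow> (\<forall>\<phi>\<in>\<Gamma>. satisfies R \<phi>)"

definition strict_consequence :: "stheory \<Rightarrow> sform \<Rightarrow> bool" where
  "strict_consequence \<Gamma> \<phi> \<longleftrightarrow>
     (\<forall>R. frame R \<longrightarrow> satisfies_theory R \<Gamma> \<longrightarrow> satisfies R \<phi>)"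

section \<open>Goedel numbering\<close>

text \<open>Syntax is coded by a constructor tag and the codes of the arguments, using the Cantor
  pairing function; a finite set of s-formulas is coded by its canonical index, that is, the sum of
  \<open>2 ^ c\<close> over the codes \<open>c\<close> of its members.\<close>

primrec form_code :: "form \<Rightarrow> nat" where
  "form_code (Var i) = prod_encode (0, i)"
| "form_code (Neg A) = prod_encode (1, form_code A)"
| "form_code (Conj A B) = prod_encode (2, prod_encode (form_code A, form_code B))"
| "form_code (Disj A B) = prod_encode (3, prod_encode (form_code A, form_code B))"
| "form_code (Impl A B) = prod_encode (4, prod_encode (form_code A, form_code B))"

primrec sform_code :: "sform \<Rightarrow> nat" where
  "sform_code (StrictImp A B) = prod_encode (0, prod_encode (form_code A, form_code B))"
| "sform_code (StrictNonimp A B) = prod_encode (1, prod_encode (form_code A, form_code B))"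

text \<open>Meaningful only for finite sets: \<^const>\<open>set_encode\<close> sends every infinite set to 0.\<close>

definition stheory_code :: "stheory \<Rightarrow> nat" where
  "stheory_code \<Gamma> = set_encode (sform_code ` \<Gamma>)"

fun sequent_code :: "stheory \<times> sform \<Rightarrow> nat" where
  "sequent_code (\<Gamma>, \<phi>) = prod_encode (stheory_code \<Gamma>, sform_code \<phi>)"

lemma form_code_eq_iff [simp]: "form_code A = form_code B \<longleftrightarrow> A = B"
  by (induction A arbitrary: B; case_tac B; simp add: prod_encode_eq)

lemma sform_code_eq_iff [simp]: "sform_code \<phi> = sform_code \<psi> \<longleftrightarrow> \<phi> = \<psi>"
  by (cases \<phi>; cases \<psi>) (simp_all add: prod_encode_eq)

lemma inj_on_sequent_code: "inj_on sequent_code {(\<Gamma>, \<phi>). finite \<Gamma>}"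
proof -
  have "inj sform_code"
    by (simp add: inj_def)
  then show ?thesis
    by (auto simp: inj_on_def prod_encode_eq stheory_code_def set_encode_eq inj_image_eq_iff)
qed

section \<open>Computable sets of natural numbers\<close>

datatype recf =
    Zero
  | Succ
  | Proj nat
  | Comp recf "recf list"
  | PrimRec recf recf
  | Mu recf

text \<open>Graphs of the partial recursive functions: \<open>computes f xs y\<close> means that \<open>f\<close> halts on the
  argument tuple \<open>xs\<close> with value \<open>y\<close>. Arities are not part of the syntax: \<open>Zero\<close> and \<open>Proj i\<close>
  stand for the constant and projection functions of every suitable arity, and an ill-formed
  application has no value. In \<open>PrimRec\<close> and \<open>Mu\<close> the first argument is the
  recursion, respectively search, variable, and \<open>Mu\<close> requires all earlier values to be defined
  and nonzero.\<close>

inductive computes :: "recf \<Rightarrow> nat list \<Rightarrow> nat \<Rightarrow> bool" where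
  zero: "computes Zero xs 0"
| succ: "computes Succ [x] (Suc x)"
| proj: "i < length xs \<Longrightarrow> computes (Proj i) xs (xs ! i)"
| comp: "\<lbrakk>list_all2 (\<lambda>g y. computes g xs y) gs ys; computes f ys z\<rbrakk>
    \<Longrightarrow> computes (Comp f gs) xs z"
| primrec_0: "computes f xs y \<Longrightarrow> computes (PrimRec f g) (0 # xs) y"
| primrec_Suc: "\<lbrakk>computes (PrimRec f g) (n # xs) y; computes g (n # y # xs) z\<rbrakk>
    \<Longrightarrow> computes (PrimRec f g) (Suc n # xs) z"
| mu: "\<lbrakk>computes f (n # xs) 0; \<And>m. m < n \<Longrightarrow> \<exists>y. computes f (m # xs) (Suc y)\<rbrakk>
    \<Longrightarrow> computes (Mu f) xs n"
monos list_all2_mono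

lemma computes_deterministic: "computes f xs y \<Longrightarrow> computes f xs z \<Longrightarrow> y = z"
proof (induction arbitrary: z rule: computes.induct)
  case (comp xs gs ys f y)
  from comp.prems obtain ys' where ys': "list_all2 (\<lambda>g y. computes g xs y) gs ys'"
    and z: "computes f ys' z"
    by (cases rule: computes.cases) auto
  from comp.IH(1) ys' have "ys = ys'"
    by (auto simp: list_all2_conv_all_nth intro!: nth_equalityI)
  with z comp.IH(2) show ?case by blast
next
  case (primrec_Suc f g n xs y v)
  from primrec_Suc.prems obtain y' where "computes (PrimRec f g) (n # xs) y'"
    and "computes g (n # y' # xs) z"
    by (cases rule: computes.cases) auto
  with primrec_Suc.IH show ?case by metis
next
  case (mu f n xs)
  from mu.prems have z: "computes f (z # xs) 0"
    and below: "\<And>m. m < z \<Longrightarrow> \<exists>y. computes f (m # xs) (Suc y)"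
    by (cases rule: computes.cases; blast)+
  from mu.IH(2) z have "\<not> z < n" by fastforce
  moreover from mu.IH(1) below have "\<not> n < z" by fastforce
  ultimately show ?case by simp
qed (erule computes.cases; simp)+

definition computable_set :: "nat set \<Rightarrow> bool" where
  "computable_set S \<longleftrightarrow> (\<exists>f. \<forall>n. computes f [n] (if n \<in> S then 1 else 0))"

end

theory Submission imports Defs begin

text \<open>\<open>\<phi>\<close> follows from \<open>\<Gamma>\<close> iff \<open>\<Gamma>\<close> together with the opposite of \<open>\<phi>\<close> has no frame, and a theory has a
  frame iff the set of all valuations obeying its implications is nonempty and realises each of its
  nonimplications. Only the truth values of formulas with codes up to that of the whole sequent
  matter, and these form a finite set of codes. So the question is one of bounded quantification
  over canonical indices of finite sets, and neither decoding of syntax nor course-of-values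
  recursion is needed: the set of formula codes is itself quantified over and pinned down by its
  closure conditions.\<close>

section \<open>Closure properties of the recursive functions\<close>

text \<open>A function of \<open>k\<close> arguments is presented as a function of an environment that looks at no more
  than its first \<open>k\<close> entries, so that binding a variable shifts the environment by one, and
  computability can be proved by resolution along the shape of an expression.\<close>

definition computable :: "nat \<Rightarrow> ((nat \<Rightarrow> nat) \<Rightarrow> nat) \<Rightarrow> bool" where
  "computable k F \<longleftrightarrow> (\<exists>f. \<forall>e. computes f (map e [0..<k]) (F e))"

definition decidable :: "nat \<Rightarrow> ((nat \<Rightarrow> nat) \<Rightarrow> bool) \<Rightarrow> bool" where
  "decidable k P \<longleftrightarrow> computable k (\<lambda>e. if P e then 1 else 0)"

lemma computable_var: "i < k \<Longrightarrow> computable k (\<lambda>e. e i)"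
proof -
  assume "i < k"
  then have "computes (Proj i) (map e [0..<k]) (e i)" for e
    using computes.proj[of i "map e [0..<k]"] by simp
  then show ?thesis unfolding computable_def by blast
qed

text \<open>Composition. Only the members of \<open>g\<close> with index below \<open>m\<close>
  matter, because a function computed from \<open>m\<close> arguments cannot see later
  entries.\<close>

lemma computable_subst:
  assumes F: "computable m F" and g: "\<And>i. i < m \<Longrightarrow> computable k (g i)"
  shows "computable k (\<lambda>e. F (\<lambda>i. g i e))"
proof -
  obtain f where f: "\<And>e. computes f (map e [0..<m]) (F e)"
    using F unfolding computable_def by blast
  \<comment> \<open>Keeping the bound on \<open>i\<close> under the existential lets choice return a
    family \<open>r\<close> defined on all indices.\<close>
  have "\<exists>r. i < m \<longrightarrow> (\<forall>e. computes r (map e [0..<k]) (g i e))" for i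
    using g[of i] unfolding computable_def by blast
  then obtain r where r: "\<And>i e. i < m \<Longrightarrow> computes (r i) (map e [0..<k]) (g i e)"
    by metis
  have "computes (Comp f (map r [0..<m])) (map e [0..<k]) (F (\<lambda>i. g i e))" for e
    using r f[of "\<lambda>i. g i e"]
    by (intro computes.comp[where ys = "map (\<lambda>i. g i e) [0..<m]"])
      (auto simp: list_all2_conv_all_nth)
  then show ?thesis unfolding computable_def by blast
qed

lemma computable_Suc: "computable k a \<Longrightarrow> computable k (\<lambda>e. Suc (a e))"
proof -
  have "computable 1 (\<lambda>e. Suc (e 0))"
    unfolding computable_def by (rule exI[of _ Succ]) (simp add: computes.succ)
  from computable_subst[OF this, of k "\<lambda>_. a"]
  show "computable k a \<Longrightarrow> computable k (\<lambda>e. Suc (a e))" by simp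
qed

lemma computable_const: "computable k (\<lambda>e. c)"
proof (induction c)
  case 0
  show ?case unfolding computable_def using computes.zero by blast
next
  case (Suc c)
  then show ?case by (rule computable_Suc)
qed

text \<open>\<open>PrimRec\<close> hands its step function the counter, the previous value and then
  the parameters, so the step lives in an environment shifted by two.\<close>

lemma computable_rec_nat:
  assumes Z: "computable k Z"
    and S: "computable (Suc (Suc k)) (\<lambda>e. S (e 0) (e (Suc 0)) (\<lambda>i. e (Suc (Suc i))))"
    and N: "computable k N"
  shows "computable k (\<lambda>e. rec_nat (Z e) (\<lambda>n y. S n y e) (N e))"
proof -
  obtain z where z: "\<And>e. computes z (map e [0..<k]) (Z e)"
    using Z unfolding computable_def by blast
  obtain s where s: "\<And>e. computes s (map e [0..<Suc (Suc k)])
      (S (e 0) (e (Suc 0)) (\<lambda>i. e (Suc (Suc i))))"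
    using S unfolding computable_def by blast
  have s': "computes s (n # y # map e [0..<k]) (S n y e)" for n y e
    using s[of "case_nat n (case_nat y e)"]
    by (simp add: upt_conv_Cons map_Suc_upt[symmetric] comp_def del: upt_Suc)
  have "computes (PrimRec z s) (n # map e [0..<k]) (rec_nat (Z e) (\<lambda>n y. S n y e) n)" for n e
    by (induction n) (auto intro: computes.primrec_0 computes.primrec_Suc z s')
  then have "computes (PrimRec z s) (map e [0..<Suc k])
      (rec_nat (Z (\<lambda>i. e (Suc i))) (\<lambda>n y. S n y (\<lambda>i. e (Suc i))) (e 0))" for e
    by (simp add: upt_conv_Cons map_Suc_upt[symmetric] comp_def del: upt_Suc)
  then have "computable (Suc k)
      (\<lambda>e. rec_nat (Z (\<lambda>i. e (Suc i))) (\<lambda>n y. S n y (\<lambda>i. e (Suc i))) (e 0))"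
    unfolding computable_def by blast
  \<comment> \<open>So far the recursion variable is entry 0; substituting \<open>N\<close> for it
    and shifting the parameters back gives recursion up to \<open>N e\<close>.\<close>
  from computable_subst[OF this, of k "case_nat N (\<lambda>i e. e i)"] N show ?thesis
    by (simp add: computable_var split: nat.split)
qed

lemma computable_lift2:
  assumes "computable (Suc (Suc 0)) (\<lambda>e. h (e 0) (e (Suc 0)))" "computable k a" "computable k b"
  shows "computable k (\<lambda>e. h (a e) (b e))"
  using computable_subst[OF assms(1), of k "case_nat a (\<lambda>_. b)"] assms(2,3)
  by (simp split: nat.split)

lemma computable_lift1:
  assumes "computable (Suc 0) (\<lambda>e. h (e 0))" "computable k a"
  shows "computable k (\<lambda>e. h (a e))"
  using computable_subst[OF assms(1), of k "\<lambda>_. a"] assms(2) by simp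

section \<open>Arithmetic functions\<close>

lemma computable_add: "computable k a \<Longrightarrow> computable k b \<Longrightarrow> computable k (\<lambda>e. a e + b e)"
proof (rule computable_lift2[where h = "(+)"])
  have "x + y = rec_nat x (\<lambda>_ v. Suc v) y" for x y :: nat by (induction y) auto
  then show "computable (Suc (Suc 0)) (\<lambda>e. e 0 + e (Suc 0))"
    by (simp only:) (intro computable_rec_nat computable_Suc computable_var; simp)
qed

lemma computable_diff: "computable k a \<Longrightarrow> computable k b \<Longrightarrow> computable k (\<lambda>e. a e - b e)"
proof (rule computable_lift2[where h = "(-)"])
  \<comment> \<open>The predecessor is a recursion that returns its counter and ignores the previous
    value; truncated subtraction iterates it.\<close>
  have pred: "v - 1 = rec_nat 0 (\<lambda>n _. n) v" for v :: nat by (cases v) auto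
  have "x - y = rec_nat x (\<lambda>_ v. rec_nat 0 (\<lambda>n _. n) v) y" for x y :: nat
    by (induction y) (auto simp: pred[symmetric])
  then show "computable (Suc (Suc 0)) (\<lambda>e. e 0 - e (Suc 0))"
    by (simp only:) (intro computable_rec_nat computable_const computable_var; simp)
qed

lemma computable_power2: "computable k a \<Longrightarrow> computable k (\<lambda>e. 2 ^ a e)"
proof (rule computable_lift1[where h = "\<lambda>x. 2 ^ x"])
  have "(2::nat) ^ x = rec_nat 1 (\<lambda>_ v. v + v) x" for x by (induction x) auto
  then show "computable (Suc 0) (\<lambda>e. 2 ^ e 0)"
    by (simp only:) (intro computable_rec_nat computable_add computable_const computable_var; simp)
qed

lemma computable_mult: "computable k a \<Longrightarrow> computable k b \<Longrightarrow> computable k (\<lambda>e. a e * b e)"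
proof (rule computable_lift2[where h = "(*)"])
  have "x * y = rec_nat 0 (\<lambda>_ v. x + v) y" for x y :: nat by (induction y) auto
  then show "computable (Suc (Suc 0)) (\<lambda>e. e 0 * e (Suc 0))"
    by (simp only:) (intro computable_rec_nat computable_add computable_const computable_var; simp)
qed

lemma computable_prod_encode:
  "computable k a \<Longrightarrow> computable k b \<Longrightarrow> computable k (\<lambda>e. prod_encode (a e, b e))"
proof (rule computable_lift2[where h = "\<lambda>x y. prod_encode (x, y)"])
  have "triangle x = rec_nat 0 (\<lambda>n v. v + Suc n) x" for x by (induction x) auto
  then have "prod_encode (x, y) = rec_nat 0 (\<lambda>n v. v + Suc n) (x + y) + x" for x y
    by (simp add: prod_encode_def)
  then show "computable (Suc (Suc 0)) (\<lambda>e. prod_encode (e 0, e (Suc 0)))"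
    by (simp only:)
      (intro computable_rec_nat computable_add computable_Suc computable_const computable_var; simp)
qed

section \<open>Case distinction, connectives and bounded quantifiers\<close>

lemma computable_if:
  assumes "decidable k P" "computable k a" "computable k b"
  shows "computable k (\<lambda>e. if P e then a e else b e)"
proof -
  \<comment> \<open>The truth value serves as the number of recursion steps: none leaves
    \<open>b e\<close>, one replaces it by \<open>a e\<close>.\<close>
  have eq: "(\<lambda>e. if P e then a e else b e) =
      (\<lambda>e. rec_nat (b e) (\<lambda>_ _. a e) (if P e then 1 else 0))"
    by auto
  have "computable (Suc (Suc k)) (\<lambda>e. a (\<lambda>i. e (Suc (Suc i))))"
    using assms(2) by (rule computable_subst) (simp add: computable_var)
  then show ?thesis
    unfolding eq using assms(1,3) unfolding decidable_def by (intro computable_rec_nat)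
qed

lemma decidable_subst:
  assumes "decidable (length gs) P" "\<And>g. g \<in> set gs \<Longrightarrow> computable k g"
  shows "decidable k (\<lambda>e. P (\<lambda>i. (gs ! i) e))"
  using computable_subst[OF assms(1)[unfolded decidable_def], of k "(!) gs"] assms(2)
  unfolding decidable_def by simp

lemma decidable_not: "decidable k P \<Longrightarrow> decidable k (\<lambda>e. \<not> P e)"
proof -
  have "(\<lambda>e. if \<not> P e then 1 else 0) = (\<lambda>e. if P e then 0 else (1::nat))"
    by auto
  then show "decidable k P \<Longrightarrow> decidable k (\<lambda>e. \<not> P e)"
    using computable_if[of k P "\<lambda>_. 0" "\<lambda>_. 1"] computable_const
    unfolding decidable_def by simp
qed

lemma decidable_conj:
  assumes "decidable k P" "decidable k Q"
  shows "decidable k (\<lambda>e. P e \<and> Q e)"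
proof -
  have "(\<lambda>e. if P e \<and> Q e then 1 else (0::nat)) = (\<lambda>e. if P e then if Q e then 1 else 0 else 0)"
    by auto
  then show ?thesis
    using computable_if[OF assms(1) assms(2)[unfolded decidable_def] computable_const[of k 0]]
    unfolding decidable_def by simp
qed

lemma decidable_imp:
  assumes "decidable k P" "decidable k Q"
  shows "decidable k (\<lambda>e. P e \<longrightarrow> Q e)"
  using decidable_not[OF decidable_conj[OF assms(1) decidable_not[OF assms(2)]]] by simp

lemma decidable_disj:
  assumes "decidable k P" "decidable k Q"
  shows "decidable k (\<lambda>e. P e \<or> Q e)"
  using decidable_imp[OF decidable_not[OF assms(1)] assms(2)]
  by (simp only: disj_imp)

lemma decidable_iff: "decidable k P \<Longrightarrow> decidable k Q \<Longrightarrow> decidable k (\<lambda>e. P e \<longleftrightarrow> Q e)"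
  unfolding iff_conv_conj_imp by (intro decidable_conj decidable_imp)

lemma decidable_eq:
  assumes "computable k a" "computable k b"
  shows "decidable k (\<lambda>e. a e = b e)"
proof -
  have "(\<lambda>e. if a e = b e then 1 else 0) = (\<lambda>e. 1 - ((a e - b e) + (b e - a e)))"
    by auto
  with assms show ?thesis
    unfolding decidable_def
    by (simp only:) (intro computable_diff computable_add computable_const)
qed

text \<open>Bounded search is a recursion on the bound whose value becomes 1 at a witness and stays
  there.\<close>

lemma decidable_ex:
  assumes "computable k B" "decidable (Suc k) (\<lambda>e. Q (e 0) (\<lambda>i. e (Suc i)))"
  shows "decidable k (\<lambda>e. \<exists>i<B e. Q i e)"
proof -
  have "rec_nat 0 (\<lambda>i y. if Q i e then 1 else y) n = (if \<exists>i<n. Q i e then 1 else (0::nat))" for n e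
    by (induction n) (auto simp: less_Suc_eq)
  then have eq: "(\<lambda>e. if \<exists>i<B e. Q i e then 1 else (0::nat)) =
      (\<lambda>e. rec_nat 0 (\<lambda>i y. if Q i e then 1 else y) (B e))"
    by simp
  \<comment> \<open>The recursion step has the previous value as entry 1, so \<open>Q\<close> must
    take its parameters from entry 2 onwards.\<close>
  have "computable (Suc (Suc k)) (\<lambda>e. if Q (e 0) (\<lambda>i. e (Suc (Suc i))) then 1 else 0)"
    using computable_subst[OF assms(2)[unfolded decidable_def], of "Suc (Suc k)"
        "case_nat (\<lambda>e. e 0) (\<lambda>i e. e (Suc (Suc i)))"]
    by (simp add: computable_var split: nat.split)
  then have Q: "decidable (Suc (Suc k)) (\<lambda>e. Q (e 0) (\<lambda>i. e (Suc (Suc i))))"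
    unfolding decidable_def .
  show ?thesis
    unfolding decidable_def eq
    by (intro computable_rec_nat computable_if computable_const computable_var assms(1) Q) simp
qed

lemma decidable_all:
  assumes "computable k B" "decidable (Suc k) (\<lambda>e. Q (e 0) (\<lambda>i. e (Suc i)))"
  shows "decidable k (\<lambda>e. \<forall>i<B e. Q i e)"
  using decidable_not[OF decidable_ex[OF assms(1), of "\<lambda>i e. \<not> Q i e", OF decidable_not[OF assms(2)]]]
  by simp

text \<open>Bit \<open>c\<close> of \<open>t\<close> is set iff the quotient of \<open>t\<close> by
  \<open>2 ^ c\<close> is odd. Naming the quotient as \<open>q + Suc q\<close> and the remainder as
  \<open>r\<close> expresses this by bounded quantifiers over sums, products and powers.\<close>

lemma mem_set_decode_iff:
  "c \<in> set_decode t \<longleftrightarrow> (\<exists>q<Suc t. \<exists>r<2 ^ c. t = (q + Suc q) * 2 ^ c + r)"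
proof
  assume "c \<in> set_decode t"
  then obtain q where q: "t div 2 ^ c = 2 * q + 1"
    by (auto simp: set_decode_def elim: oddE)
  have "q \<le> t div 2 ^ c" using q by simp
  also have "\<dots> \<le> t" by (rule div_le_dividend)
  finally have "q < Suc t" by simp
  moreover have "t = (q + Suc q) * 2 ^ c + t mod 2 ^ c"
    using div_mult_mod_eq[of t "2 ^ c"] q by (simp add: mult_2)
  ultimately show "\<exists>q<Suc t. \<exists>r<2 ^ c. t = (q + Suc q) * 2 ^ c + r"
    by (metis mod_less_divisor zero_less_numeral zero_less_power)
next
  assume "\<exists>q<Suc t. \<exists>r<2 ^ c. t = (q + Suc q) * 2 ^ c + r"
  then obtain q r where "r < 2 ^ c" "t = (q + Suc q) * 2 ^ c + r" by blast
  then have "t div 2 ^ c = q + Suc q" by (simp del: add_Suc_right)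
  then show "c \<in> set_decode t" by (simp add: set_decode_def)
qed

lemma decidable_mem_set_decode:
  assumes "computable k a" "computable k b"
  shows "decidable k (\<lambda>e. a e \<in> set_decode (b e))"
proof -
  have "computable (Suc (Suc 0)) (\<lambda>e. if e 0 \<in> set_decode (e (Suc 0)) then 1 else 0)"
    unfolding mem_set_decode_iff decidable_def[symmetric]
    by (intro decidable_ex decidable_eq computable_add computable_mult computable_power2
        computable_Suc computable_var; simp)
  from computable_lift2[OF this assms] show ?thesis unfolding decidable_def .
qed

lemmas decidable_intros =
  decidable_ex decidable_all decidable_iff decidable_imp decidable_disj decidable_conj decidable_not
  decidable_eq decidable_mem_set_decode computable_prod_encode computable_power2 computable_Suc
  computable_const computable_var

section \<open>Sets of codes\<close>

text \<open>Distinct powers of two with exponents below \<open>n\<close> sum to at most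
  \<open>2 ^ n - 1\<close>. This makes quantifying over sets of codes a bounded search.\<close>

lemma set_encode_less_power2:
  assumes "A \<subseteq> {..<n}"
  shows "set_encode A < 2 ^ n"
proof -
  have "set_encode A \<le> (\<Sum>i<n. 2 ^ i)"
    unfolding set_encode_def by (rule sum_mono2) (use assms in auto)
  also have "\<dots> < 2 ^ n"
    by (induction n) auto
  finally show ?thesis .
qed

text \<open>A set bit contributes \<open>2 ^ c\<close>, which exceeds \<open>c\<close>. Thus a bound
  on the code of a theory also bounds the codes of its members.\<close>

lemma mem_set_decode_less: "c \<in> set_decode a \<Longrightarrow> c < a"
proof -
  assume "c \<in> set_decode a"
  then have "2 ^ c \<le> a"
    by (metis set_decode_def div_less even_zero mem_Collect_eq not_less)
  then show "c < a" using less_exp[of c] by linarith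
qed

text \<open>The code is \<open>triangle (k + x) + k\<close>, and \<open>triangle\<close> dominates
  its argument. Tag 0 would not do, as \<open>prod_encode (0, 0) = 0\<close>, but all connectives
  have positive tags.\<close>

lemma prod_encode_greater: "0 < k \<Longrightarrow> x < prod_encode (k, x)"
proof -
  have "n \<le> triangle n" for n by (induction n) auto
  then show "0 < k \<Longrightarrow> x < prod_encode (k, x)"
    unfolding prod_encode_def by (auto intro: less_le_trans[of _ "k + x"] simp: trans_le_add1)
qed

text \<open>The clauses determine the part of \<open>F\<close> below \<open>N\<close>, since arguments have smaller codes than the
  formula they occur in.\<close>

definition form_codes_upto :: "nat \<Rightarrow> nat set \<Rightarrow> bool" where
  "form_codes_upto N F \<longleftrightarrow> (\<forall>c<N. c \<in> F \<longleftrightarrow>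
     (\<exists>x<Suc c. c = prod_encode (0, x) \<or> c = prod_encode (1, x) \<and> x \<in> F \<or>
       (\<exists>y<Suc c. (c = prod_encode (2, prod_encode (x, y)) \<or> c = prod_encode (3, prod_encode (x, y)) \<or>
         c = prod_encode (4, prod_encode (x, y))) \<and> x \<in> F \<and> y \<in> F)))"

text \<open>A set of codes respecting the connectives stands for a valuation; variables are
  unconstrained.\<close>

definition truth_set :: "nat \<Rightarrow> nat set \<Rightarrow> nat set \<Rightarrow> bool" where
  "truth_set N F T \<longleftrightarrow> (\<forall>c<N. c \<in> F \<longrightarrow> (\<forall>x<N. \<forall>y<N.
     (c = prod_encode (1, x) \<longrightarrow> (c \<in> T \<longleftrightarrow> x \<notin> T)) \<and>
     (c = prod_encode (2, prod_encode (x, y)) \<longrightarrow> (c \<in> T \<longleftrightarrow> x \<in> T \<and> y \<in> T)) \<and>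
     (c = prod_encode (3, prod_encode (x, y)) \<longrightarrow> (c \<in> T \<longleftrightarrow> x \<in> T \<or> y \<in> T)) \<and>
     (c = prod_encode (4, prod_encode (x, y)) \<longrightarrow> (c \<in> T \<longleftrightarrow> (x \<in> T \<longrightarrow> y \<in> T)))))"

section \<open>Formula codes as the unique solution of the clauses\<close>

lemma form_code_args_less:
  "form_code A < form_code (Neg A)"
  "form_code A < form_code (Conj A B)" "form_code B < form_code (Conj A B)"
  "form_code A < form_code (Disj A B)" "form_code B < form_code (Disj A B)"
  "form_code A < form_code (Impl A B)" "form_code B < form_code (Impl A B)"
  by (auto intro: prod_encode_greater le_less_trans[OF le_prod_encode_1 prod_encode_greater]
      le_less_trans[OF le_prod_encode_2 prod_encode_greater])

lemma form_codes_upto_range: "form_codes_upto N (range form_code \<inter> {..<N})"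
  unfolding form_codes_upto_def
proof (intro allI impI)
  fix c assume c: "c < N"
  let ?F = "range form_code \<inter> {..<N}"
  show "c \<in> ?F \<longleftrightarrow> (\<exists>x<Suc c. c = prod_encode (0, x) \<or> c = prod_encode (1, x) \<and> x \<in> ?F \<or>
       (\<exists>y<Suc c. (c = prod_encode (2, prod_encode (x, y)) \<or> c = prod_encode (3, prod_encode (x, y)) \<or>
         c = prod_encode (4, prod_encode (x, y))) \<and> x \<in> ?F \<and> y \<in> ?F))" (is "_ \<longleftrightarrow> ?R")
  proof
    assume "c \<in> ?F"
    then obtain A where A: "c = form_code A" by blast
    show ?R
    proof (cases A)
      case (Var i)
      \<comment> \<open>\<open>Var 0\<close> has code 0, so the bound on \<open>x\<close> has to be
        \<open>Suc c\<close> rather than \<open>c\<close>.\<close>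
      then show ?thesis using A by (intro exI[of _ i]) (simp add: le_prod_encode_2 le_imp_less_Suc)
    next
      case (Neg B)
      then show ?thesis using A c form_code_args_less(1)[of B]
        by (intro exI[of _ "form_code B"]) auto
    next
      case (Conj B C)
      then show ?thesis using A c form_code_args_less(2,3)[where A = B and B = C]
        by (intro exI[of _ "form_code B"], intro conjI disjI2, simp)
          (rule exI[of _ "form_code C"], auto)
    next
      case (Disj B C)
      then show ?thesis using A c form_code_args_less(4,5)[where A = B and B = C]
        by (intro exI[of _ "form_code B"], intro conjI disjI2, simp)
          (rule exI[of _ "form_code C"], auto)
    next
      case (Impl B C)
      then show ?thesis using A c form_code_args_less(6,7)[where A = B and B = C]
        by (intro exI[of _ "form_code B"], intro conjI disjI2, simp)
          (rule exI[of _ "form_code C"], auto)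
    qed
  next
    assume ?R
    then obtain x where "c = prod_encode (0, x) \<or> c = prod_encode (1, x) \<and> x \<in> range form_code \<or>
       (\<exists>y. (c = prod_encode (2, prod_encode (x, y)) \<or> c = prod_encode (3, prod_encode (x, y)) \<or>
         c = prod_encode (4, prod_encode (x, y))) \<and> x \<in> range form_code \<and> y \<in> range form_code)"
      by blast
    moreover have var: "prod_encode (0, x) \<in> range form_code" for x
      by (rule range_eqI[of _ _ "Var x"]) simp
    moreover have neg: "prod_encode (1, x) \<in> range form_code" if x: "x \<in> range form_code" for x
    proof -
      obtain A where "x = form_code A" using x by blast
      then show ?thesis by (intro range_eqI[of _ _ "Neg A"]) simp
    qed
    moreover have bin: "prod_encode (2, prod_encode (x, y)) \<in> range form_code"
        "prod_encode (3, prod_encode (x, y)) \<in> range form_code"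
        "prod_encode (4, prod_encode (x, y)) \<in> range form_code"
      if xy: "x \<in> range form_code" "y \<in> range form_code" for x y
    proof -
      obtain A B where "x = form_code A" "y = form_code B" using xy by blast
      then show "prod_encode (2, prod_encode (x, y)) \<in> range form_code"
        "prod_encode (3, prod_encode (x, y)) \<in> range form_code"
        "prod_encode (4, prod_encode (x, y)) \<in> range form_code"
        by (simp_all add: range_eqI[of _ _ "Conj A B"] range_eqI[of _ _ "Disj A B"]
            range_eqI[of _ _ "Impl A B"])
    qed
    ultimately have "c \<in> range form_code"
      by (elim disjE conjE exE) (simp_all only: var neg bin)
    then show "c \<in> ?F" using c by simp
  qed
qed

text \<open>Strong induction: apart from the tag equations, the clause for \<open>c\<close> asks
  only about membership of numbers below \<open>c\<close>. Hence any \<open>F\<close> passing the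
  check can stand in for the true set of formula codes.\<close>

lemma form_codes_upto_unique:
  assumes F: "form_codes_upto N F" and G: "form_codes_upto N G"
  shows "c < N \<Longrightarrow> c \<in> F \<longleftrightarrow> c \<in> G"
proof (induction c rule: less_induct)
  case (less c)
  have IH: "x \<in> F \<longleftrightarrow> x \<in> G" if "x < c" for x
    using less that by auto
  have "x < c" if "c = prod_encode (k, x)" "0 < k" for k x
    using that prod_encode_greater by simp
  moreover have "x < c \<and> y < c" if "c = prod_encode (k, prod_encode (x, y))" "0 < k" for k x y
    using that le_less_trans[OF le_prod_encode_1 prod_encode_greater]
      le_less_trans[OF le_prod_encode_2 prod_encode_greater] by simp
  \<comment> \<open>Each equation for \<open>c\<close> puts its arguments below \<open>c\<close>, so
    under it the induction hypothesis may swap \<open>F\<close> for \<open>G\<close>.\<close>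
  ultimately have one: "c = prod_encode (1, x) \<and> x \<in> F \<longleftrightarrow> c = prod_encode (1, x) \<and> x \<in> G"
    and two: "(c = prod_encode (2, prod_encode (x, y)) \<or> c = prod_encode (3, prod_encode (x, y)) \<or>
         c = prod_encode (4, prod_encode (x, y))) \<and> x \<in> F \<and> y \<in> F \<longleftrightarrow>
       (c = prod_encode (2, prod_encode (x, y)) \<or> c = prod_encode (3, prod_encode (x, y)) \<or>
         c = prod_encode (4, prod_encode (x, y))) \<and> x \<in> G \<and> y \<in> G" for x y
    using IH by (metis zero_less_numeral zero_less_one)+
  show ?case
    using F[unfolded form_codes_upto_def, rule_format, OF less.prems]
      G[unfolded form_codes_upto_def, rule_format, OF less.prems]
    by (simp only: one two)
qed

lemma form_codes_upto_iff:
  assumes "form_codes_upto N F" "c < N"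
  shows "c \<in> F \<longleftrightarrow> c \<in> range form_code"
  using form_codes_upto_unique[OF assms(1) form_codes_upto_range assms(2)] assms(2) by simp

section \<open>Truth sets and valuations\<close>

lemma truth_set_val:
  assumes F: "form_codes_upto N F" and T: "truth_set N F T"
  shows "form_code A < N \<Longrightarrow> form_code A \<in> T \<longleftrightarrow> val (\<lambda>i. form_code (Var i) \<in> T) A"
proof (induction A)
  case (Var i)
  then show ?case by simp
next
  case (Neg A)
  have "form_code (Neg A) \<in> F" using form_codes_upto_iff[OF F Neg.prems] by blast
  moreover have "form_code A < N" using Neg.prems form_code_args_less(1) less_trans by blast
  ultimately show ?case
    \<comment> \<open>All connectives share the quantifiers over \<open>x\<close> and
      \<open>y\<close>; for negation \<open>y\<close> is a dummy, filled with the same code.\<close>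
    using T[unfolded truth_set_def, rule_format, of "form_code (Neg A)" "form_code A" "form_code A"]
      Neg by simp
next
  case (Conj A B)
  have "form_code (Conj A B) \<in> F" using form_codes_upto_iff[OF F Conj.prems] by blast
  moreover have "form_code A < N" "form_code B < N"
    using Conj.prems form_code_args_less less_trans by blast+
  ultimately show ?case
    using T[unfolded truth_set_def, rule_format, of "form_code (Conj A B)" "form_code A" "form_code B"]
      Conj by simp
next
  case (Disj A B)
  have "form_code (Disj A B) \<in> F" using form_codes_upto_iff[OF F Disj.prems] by blast
  moreover have "form_code A < N" "form_code B < N"
    using Disj.prems form_code_args_less less_trans by blast+
  ultimately show ?case
    using T[unfolded truth_set_def, rule_format, of "form_code (Disj A B)" "form_code A" "form_code B"]
      Disj by simp
next
  case (Impl A B)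
  have "form_code (Impl A B) \<in> F" using form_codes_upto_iff[OF F Impl.prems] by blast
  moreover have "form_code A < N" "form_code B < N"
    using Impl.prems form_code_args_less less_trans by blast+
  ultimately show ?case
    using T[unfolded truth_set_def, rule_format, of "form_code (Impl A B)" "form_code A" "form_code B"]
      Impl by simp
qed

text \<open>Cutting off at \<open>N\<close> makes the set finite, so that it has a canonical index,
  which is then below \<open>2 ^ N\<close>.\<close>

definition val_codes :: "nat \<Rightarrow> valuation \<Rightarrow> nat set" where
  "val_codes N w = form_code ` {A. val w A} \<inter> {..<N}"

lemma mem_val_codes: "form_code A < N \<Longrightarrow> form_code A \<in> val_codes N w \<longleftrightarrow> val w A"
  by (auto simp: val_codes_def)

text \<open>Membership in \<open>F\<close> makes \<open>c\<close> the code of a formula, and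
  injectivity of pairing identifies the arguments in the applicable clause as codes of its immediate
  subformulas. Being below \<open>N\<close>, these are not cut off.\<close>

lemma truth_set_val_codes:
  assumes F: "form_codes_upto N F"
  shows "truth_set N F (val_codes N w)"
  unfolding truth_set_def
proof (intro allI impI)
  fix c x y assume c: "c < N" "c \<in> F" and x: "x < N" and y: "y < N"
  then obtain C where C: "c = form_code C" using form_codes_upto_iff[OF F] by blast
  then have mem: "c \<in> val_codes N w \<longleftrightarrow> val w C" using c(1) mem_val_codes by blast
  show "(c = prod_encode (1, x) \<longrightarrow> (c \<in> val_codes N w \<longleftrightarrow> x \<notin> val_codes N w)) \<and>
     (c = prod_encode (2, prod_encode (x, y)) \<longrightarrow>
       (c \<in> val_codes N w \<longleftrightarrow> x \<in> val_codes N w \<and> y \<in> val_codes N w)) \<and>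
     (c = prod_encode (3, prod_encode (x, y)) \<longrightarrow>
       (c \<in> val_codes N w \<longleftrightarrow> x \<in> val_codes N w \<or> y \<in> val_codes N w)) \<and>
     (c = prod_encode (4, prod_encode (x, y)) \<longrightarrow>
       (c \<in> val_codes N w \<longleftrightarrow> (x \<in> val_codes N w \<longrightarrow> y \<in> val_codes N w)))"
    using x y unfolding mem
    by (cases C) (auto simp: C prod_encode_eq mem_val_codes)
qed

section \<open>Strict consequence as satisfiability\<close>

primrec dual :: "sform \<Rightarrow> sform" where
  "dual (StrictImp A B) = StrictNonimp A B"
| "dual (StrictNonimp A B) = StrictImp A B"

lemma satisfies_dual: "satisfies R (dual \<phi>) \<longleftrightarrow> \<not> satisfies R \<phi>"
  by (cases \<phi>) auto

lemma strict_consequence_iff_unsat: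
  "strict_consequence \<Gamma> \<phi> \<longleftrightarrow> \<not> (\<exists>R. frame R \<and> satisfies_theory R (insert (dual \<phi>) \<Gamma>))"
  by (auto simp: strict_consequence_def satisfies_theory_def satisfies_dual)

definition admissible :: "stheory \<Rightarrow> valuation \<Rightarrow> bool" where
  "admissible \<Delta> w \<longleftrightarrow> (\<forall>A B. StrictImp A B \<in> \<Delta> \<longrightarrow> val w A \<longrightarrow> val w B)"

text \<open>A theory with a frame at all holds in the largest candidate, the set of all admissible
  valuations.\<close>

lemma satisfiable_iff_admissible:
  "(\<exists>R. frame R \<and> satisfies_theory R \<Delta>) \<longleftrightarrow> (\<exists>w. admissible \<Delta> w) \<and>
     (\<forall>A B. StrictNonimp A B \<in> \<Delta> \<longrightarrow> (\<exists>w. admissible \<Delta> w \<and> val w A \<and> \<not> val w B))"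
proof
  assume "\<exists>R. frame R \<and> satisfies_theory R \<Delta>"
  then obtain R where R: "R \<noteq> {}" and sat: "\<And>\<phi>. \<phi> \<in> \<Delta> \<Longrightarrow> satisfies R \<phi>"
    by (auto simp: frame_def satisfies_theory_def)
  have adm: "admissible \<Delta> w" if "w \<in> R" for w
    using sat that by (fastforce simp: admissible_def)
  then show "(\<exists>w. admissible \<Delta> w) \<and>
     (\<forall>A B. StrictNonimp A B \<in> \<Delta> \<longrightarrow> (\<exists>w. admissible \<Delta> w \<and> val w A \<and> \<not> val w B))"
    using R sat by fastforce
next
  assume *: "(\<exists>w. admissible \<Delta> w) \<and>
     (\<forall>A B. StrictNonimp A B \<in> \<Delta> \<longrightarrow> (\<exists>w. admissible \<Delta> w \<and> val w A \<and> \<not> val w B))"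
  have "satisfies {w. admissible \<Delta> w} \<phi>" if "\<phi> \<in> \<Delta>" for \<phi>
    using that * by (cases \<phi>) (auto simp: admissible_def)
  then show "\<exists>R. frame R \<and> satisfies_theory R \<Delta>"
    \<comment> \<open>The first conjunct makes this set nonempty, also for a theory without
      nonimplications.\<close>
    using * by (intro exI[of _ "{w. admissible \<Delta> w}"]) (auto simp: frame_def satisfies_theory_def)
qed

section \<open>The decision procedure on codes\<close>

text \<open>Here \<open>a\<close> is the code of the premises and \<open>b\<close> that of the conclusion, which enters with the
  opposite sign.\<close>

definition imp_codes :: "nat \<Rightarrow> nat \<Rightarrow> nat \<Rightarrow> nat \<Rightarrow> bool" where
  "imp_codes a b x y \<longleftrightarrow> prod_encode (0, prod_encode (x, y)) \<in> set_decode a \<or>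
     b = prod_encode (1, prod_encode (x, y))"

definition nonimp_codes :: "nat \<Rightarrow> nat \<Rightarrow> nat \<Rightarrow> nat \<Rightarrow> bool" where
  "nonimp_codes a b x y \<longleftrightarrow> prod_encode (1, prod_encode (x, y)) \<in> set_decode a \<or>
     b = prod_encode (0, prod_encode (x, y))"

definition admissible_codes :: "nat \<Rightarrow> nat set \<Rightarrow> nat \<Rightarrow> nat \<Rightarrow> nat set \<Rightarrow> bool" where
  "admissible_codes N F a b T \<longleftrightarrow> truth_set N F T \<and>
     (\<forall>x<N. \<forall>y<N. imp_codes a b x y \<longrightarrow> x \<in> T \<longrightarrow> y \<in> T)"

text \<open>This transcribes the criterion \<open>satisfiable_iff_admissible\<close>: the indices
  below \<open>2 ^ N\<close> are those of the subsets of \<open>{..<N}\<close>, which suffice to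
  record the truth values of formulas with codes below \<open>N\<close>.\<close>

definition satisfiable_codes :: "nat \<Rightarrow> nat set \<Rightarrow> nat \<Rightarrow> nat \<Rightarrow> bool" where
  "satisfiable_codes N F a b \<longleftrightarrow> (\<exists>t<2 ^ N. admissible_codes N F a b (set_decode t)) \<and>
     (\<forall>x<N. \<forall>y<N. nonimp_codes a b x y \<longrightarrow>
       (\<exists>t<2 ^ N. admissible_codes N F a b (set_decode t) \<and> x \<in> set_decode t \<and> y \<notin> set_decode t))"

definition is_sform_code :: "nat set \<Rightarrow> nat \<Rightarrow> bool" where
  "is_sform_code F c \<longleftrightarrow> (\<exists>x<Suc c. \<exists>y<Suc c. x \<in> F \<and> y \<in> F \<and>
     (c = prod_encode (0, prod_encode (x, y)) \<or> c = prod_encode (1, prod_encode (x, y))))"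

text \<open>\<open>Suc n\<close> exceeds the codes of the premises, of the conclusion and of all
  formulas in them. The set with index \<open>f\<close> is guessed, but its clauses determine it;
  the \<open>is_sform_code\<close> checks reject numbers that code no sequent.\<close>

definition valid_code :: "nat \<Rightarrow> bool" where
  "valid_code n \<longleftrightarrow> (\<exists>a<Suc n. \<exists>b<Suc n. n = prod_encode (a, b) \<and>
     (\<exists>f<2 ^ Suc n. form_codes_upto (Suc n) (set_decode f) \<and> is_sform_code (set_decode f) b \<and>
       (\<forall>c<Suc n. c \<in> set_decode a \<longrightarrow> is_sform_code (set_decode f) c) \<and>
       \<not> satisfiable_codes (Suc n) (set_decode f) a b))"

section \<open>Decidability of the procedure\<close>

lemma decidable_form_codes_upto:
  assumes "computable k N" "computable k f"
  shows "decidable k (\<lambda>e. form_codes_upto (N e) (set_decode (f e)))"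
proof -
  \<comment> \<open>The predicate is first treated with variables as arguments, where the rules
    follow the shape of the formula; the given functions are substituted afterwards.\<close>
  have "decidable (Suc (Suc 0)) (\<lambda>e. form_codes_upto (e 0) (set_decode (e (Suc 0))))"
    (is "decidable _ ?P")
    unfolding form_codes_upto_def by (intro decidable_intros) simp_all
  then show ?thesis
    using decidable_subst[of "[N, f]" ?P k] assms by auto
qed

lemma decidable_is_sform_code:
  assumes "computable k f" "computable k c"
  shows "decidable k (\<lambda>e. is_sform_code (set_decode (f e)) (c e))"
proof -
  have "decidable (Suc (Suc 0)) (\<lambda>e. is_sform_code (set_decode (e 0)) (e (Suc 0)))"
    (is "decidable _ ?P")
    unfolding is_sform_code_def by (intro decidable_intros) simp_all
  then show ?thesis
    using decidable_subst[of "[f, c]" ?P k] assms by auto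
qed

lemma decidable_truth_set:
  assumes "computable k N" "computable k f" "computable k t"
  shows "decidable k (\<lambda>e. truth_set (N e) (set_decode (f e)) (set_decode (t e)))"
proof -
  have "decidable (Suc (Suc (Suc 0))) (\<lambda>e.
      truth_set (e 0) (set_decode (e (Suc 0))) (set_decode (e (Suc (Suc 0)))))"
    (is "decidable _ ?P")
    unfolding truth_set_def by (intro decidable_intros) simp_all
  then show ?thesis
    using decidable_subst[of "[N, f, t]" ?P k] assms by auto
qed

lemma decidable_imp_codes:
  assumes "computable k a" "computable k b" "computable k x" "computable k y"
  shows "decidable k (\<lambda>e. imp_codes (a e) (b e) (x e) (y e))"
proof -
  have "decidable (Suc (Suc (Suc (Suc 0)))) (\<lambda>e.
      imp_codes (e 0) (e (Suc 0)) (e (Suc (Suc 0))) (e (Suc (Suc (Suc 0)))))"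
    (is "decidable _ ?P")
    unfolding imp_codes_def by (intro decidable_intros) simp_all
  then show ?thesis
    using decidable_subst[of "[a, b, x, y]" ?P k] assms by auto
qed

lemma decidable_nonimp_codes:
  assumes "computable k a" "computable k b" "computable k x" "computable k y"
  shows "decidable k (\<lambda>e. nonimp_codes (a e) (b e) (x e) (y e))"
proof -
  have "decidable (Suc (Suc (Suc (Suc 0)))) (\<lambda>e.
      nonimp_codes (e 0) (e (Suc 0)) (e (Suc (Suc 0))) (e (Suc (Suc (Suc 0)))))"
    (is "decidable _ ?P")
    unfolding nonimp_codes_def by (intro decidable_intros) simp_all
  then show ?thesis
    using decidable_subst[of "[a, b, x, y]" ?P k] assms by auto
qed

lemma decidable_admissible_codes:
  assumes "computable k N" "computable k f" "computable k a" "computable k b" "computable k t"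
  shows "decidable k (\<lambda>e. admissible_codes (N e) (set_decode (f e)) (a e) (b e) (set_decode (t e)))"
proof -
  have "decidable (Suc (Suc (Suc (Suc (Suc 0))))) (\<lambda>e.
      admissible_codes (e 0) (set_decode (e (Suc 0))) (e (Suc (Suc 0))) (e (Suc (Suc (Suc 0)))) (set_decode (e (Suc (Suc (Suc (Suc 0)))))))"
    (is "decidable _ ?P")
    unfolding admissible_codes_def
    by (intro decidable_intros decidable_truth_set decidable_imp_codes) simp_all
  then show ?thesis
    using decidable_subst[of "[N, f, a, b, t]" ?P k] assms by auto
qed

lemma decidable_satisfiable_codes:
  assumes "computable k N" "computable k f" "computable k a" "computable k b"
  shows "decidable k (\<lambda>e. satisfiable_codes (N e) (set_decode (f e)) (a e) (b e))"
proof -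
  have "decidable (Suc (Suc (Suc (Suc 0)))) (\<lambda>e.
      satisfiable_codes (e 0) (set_decode (e (Suc 0))) (e (Suc (Suc 0))) (e (Suc (Suc (Suc 0)))))"
    (is "decidable _ ?P")
    unfolding satisfiable_codes_def
    by (intro decidable_intros decidable_admissible_codes decidable_nonimp_codes) simp_all
  then show ?thesis
    using decidable_subst[of "[N, f, a, b]" ?P k] assms by auto
qed

lemma decidable_valid_code: "decidable (Suc 0) (\<lambda>e. valid_code (e 0))"
  unfolding valid_code_def
  by (intro decidable_intros decidable_form_codes_upto decidable_is_sform_code
      decidable_satisfiable_codes) simp_all

section \<open>Recognising the codes of s-formulas\<close>

lemma sform_code_bounds:
  "form_code A \<le> sform_code (StrictImp A B)" "form_code B \<le> sform_code (StrictImp A B)"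
  "form_code A \<le> sform_code (StrictNonimp A B)" "form_code B \<le> sform_code (StrictNonimp A B)"
  by (auto intro: order_trans[OF le_prod_encode_1 le_prod_encode_2]
      order_trans[OF le_prod_encode_2 le_prod_encode_2])

text \<open>Components have codes at most that of the s-formula, hence below \<open>N\<close>, where
  \<open>F\<close> agrees with the true formula codes. Equality does occur:
  \<open>StrictImp (Var 0) (Var 0)\<close> and \<open>Var 0\<close> both have code 0.\<close>

lemma is_sform_code_iff:
  assumes F: "form_codes_upto N F" and c: "c < N"
  shows "is_sform_code F c \<longleftrightarrow> c \<in> range sform_code"
proof
  assume "is_sform_code F c"
  then obtain x y where xy: "x \<le> c" "y \<le> c" "x \<in> F" "y \<in> F"
    and eq: "c = prod_encode (0, prod_encode (x, y)) \<or> c = prod_encode (1, prod_encode (x, y))"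
    by (auto simp: is_sform_code_def less_Suc_eq_le)
  obtain A B where "x = form_code A" "y = form_code B"
    using form_codes_upto_iff[OF F] xy c by (meson imageE le_less_trans)
  then show "c \<in> range sform_code" using eq by (metis sform_code.simps rangeI)
next
  assume "c \<in> range sform_code"
  then obtain \<phi> where \<phi>: "c = sform_code \<phi>" by blast
  have mem: "form_code A \<in> F" if "form_code A \<le> c" for A
    using form_codes_upto_iff[OF F le_less_trans[OF that c]] by simp
  show "is_sform_code F c"
  proof (cases \<phi>)
    case (StrictImp A B)
    then show ?thesis using \<phi> mem[of A] mem[of B] sform_code_bounds(1,2)[where A=A and B=B]
      by (auto simp: is_sform_code_def less_Suc_eq_le intro!: exI[of _ "form_code A"] exI[of _ "form_code B"])
  next
    case (StrictNonimp A B)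
    then show ?thesis using \<phi> mem[of A] mem[of B] sform_code_bounds(3,4)[where A=A and B=B]
      by (auto simp: is_sform_code_def less_Suc_eq_le intro!: exI[of _ "form_code A"] exI[of _ "form_code B"])
  qed
qed

section \<open>Correctness for one sequent, with both of its codes below \<open>N\<close>\<close>

context
  fixes N F \<Gamma> \<phi> a b
  assumes F: "form_codes_upto N F"
    and a: "set_decode a = sform_code ` \<Gamma>" and b: "b = sform_code \<phi>"
    and aN: "a < N" and bN: "b < N"
begin

lemma sform_code_less:
  assumes \<psi>: "\<psi> \<in> insert (dual \<phi>) \<Gamma>" and eq: "\<psi> = StrictImp A B \<or> \<psi> = StrictNonimp A B"
  shows "form_code A < N \<and> form_code B < N"
proof -
  \<comment> \<open>\<open>dual \<phi>\<close> may itself have a code of \<open>N\<close> or more,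
    since its tag can grow; then the code \<open>b\<close> of \<open>\<phi>\<close>, which has the
    same components, supplies the bound.\<close>
  have "sform_code \<psi> < N \<or> sform_code (dual \<psi>) < N"
  proof (cases "\<psi> \<in> \<Gamma>")
    case True
    then have "sform_code \<psi> \<in> set_decode a" using a by simp
    then show ?thesis using mem_set_decode_less aN less_trans by blast
  next
    case False
    then have "dual \<psi> = \<phi>" using \<psi> by (cases \<phi>) auto
    then show ?thesis using bN b by simp
  qed
  then show ?thesis
    using eq sform_code_bounds[where A=A and B=B] by (auto simp del: sform_code.simps)
qed

lemma imp_codes_iff: "imp_codes a b (form_code A) (form_code B) \<longleftrightarrow> StrictImp A B \<in> insert (dual \<phi>) \<Gamma>"
proof -
  have "sform_code (StrictImp A B) \<in> sform_code ` \<Gamma> \<longleftrightarrow> StrictImp A B \<in> \<Gamma>"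
    by (auto simp del: sform_code.simps)
  moreover have "sform_code \<phi> = sform_code (StrictNonimp A B) \<longleftrightarrow> StrictImp A B = dual \<phi>"
    unfolding sform_code_eq_iff by (cases \<phi>) auto
  ultimately show ?thesis by (auto simp: imp_codes_def a b)
qed

lemma nonimp_codes_iff:
  "nonimp_codes a b (form_code A) (form_code B) \<longleftrightarrow> StrictNonimp A B \<in> insert (dual \<phi>) \<Gamma>"
proof -
  have "sform_code (StrictNonimp A B) \<in> sform_code ` \<Gamma> \<longleftrightarrow> StrictNonimp A B \<in> \<Gamma>"
    by (auto simp del: sform_code.simps)
  moreover have "sform_code \<phi> = sform_code (StrictImp A B) \<longleftrightarrow> StrictNonimp A B = dual \<phi>"
    unfolding sform_code_eq_iff by (cases \<phi>) auto
  ultimately show ?thesis by (auto simp: nonimp_codes_def a b)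
qed

text \<open>Lets quantifiers over numbers be replaced by quantifiers over formulas: \<open>b\<close>
  and the members of \<open>set_decode a\<close> are true s-formula codes, and pairing is
  injective.\<close>

lemma imp_codes_form:
  assumes "imp_codes a b x y \<or> nonimp_codes a b x y"
  shows "\<exists>A B. x = form_code A \<and> y = form_code B"
proof -
  from assms have "prod_encode (0, prod_encode (x, y)) \<in> range sform_code \<or>
      prod_encode (1, prod_encode (x, y)) \<in> range sform_code"
    by (auto simp: imp_codes_def nonimp_codes_def a b) (metis rangeI)+
  then obtain \<psi> where "prod_encode (0, prod_encode (x, y)) = sform_code \<psi> \<or>
      prod_encode (1, prod_encode (x, y)) = sform_code \<psi>"
    by blast
  then show ?thesis by (cases \<psi>) (auto simp: prod_encode_eq)
qed

lemma admissible_val_codes: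
  assumes "admissible (insert (dual \<phi>) \<Gamma>) w"
  shows "admissible_codes N F a b (val_codes N w)"
  unfolding admissible_codes_def
proof (intro conjI allI impI truth_set_val_codes[OF F])
  fix x y assume xy: "x < N" "y < N" "imp_codes a b x y" "x \<in> val_codes N w"
  obtain A B where AB: "x = form_code A" "y = form_code B" using imp_codes_form xy(3) by blast
  have "StrictImp A B \<in> insert (dual \<phi>) \<Gamma>" using imp_codes_iff xy(3) AB by simp
  then show "y \<in> val_codes N w"
    using assms xy AB unfolding admissible_def by (metis mem_val_codes)
qed

text \<open>The implications of the theory have components with codes below \<open>N\<close>, where
  \<open>T\<close> agrees with the valuation read off from its variable codes.\<close>

lemma admissible_of_codes:
  assumes "admissible_codes N F a b T"
  shows "admissible (insert (dual \<phi>) \<Gamma>) (\<lambda>i. form_code (Var i) \<in> T)"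
  unfolding admissible_def
proof (intro allI impI)
  fix A B
  assume AB: "StrictImp A B \<in> insert (dual \<phi>) \<Gamma>" and A: "val (\<lambda>i. form_code (Var i) \<in> T) A"
  have T: "truth_set N F T" using assms by (simp add: admissible_codes_def)
  have N: "form_code A < N" "form_code B < N" using sform_code_less[OF AB] by auto
  then have "form_code A \<in> T" using A truth_set_val[OF F T] by blast
  then have "form_code B \<in> T"
    using assms N AB imp_codes_iff unfolding admissible_codes_def by blast
  then show "val (\<lambda>i. form_code (Var i) \<in> T) B" using truth_set_val[OF F T] N by blast
qed

lemma val_codes_decode:
  obtains t where "t < 2 ^ N" "set_decode t = val_codes N w"
proof
  show "set_encode (val_codes N w) < 2 ^ N"
    by (rule set_encode_less_power2) (simp add: val_codes_def)
  show "set_decode (set_encode (val_codes N w)) = val_codes N w"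
    by (rule set_encode_inverse) (simp add: val_codes_def)
qed

text \<open>Valuations and truth sets translate into each other; both passages preserve
  admissibility and the truth of formulas with codes below \<open>N\<close>.\<close>

lemma satisfiable_codes_iff:
  "satisfiable_codes N F a b \<longleftrightarrow> (\<exists>R. frame R \<and> satisfies_theory R (insert (dual \<phi>) \<Gamma>))"
proof -
  let ?\<Delta> = "insert (dual \<phi>) \<Gamma>"
  have "(\<exists>t<2 ^ N. admissible_codes N F a b (set_decode t)) \<longleftrightarrow> (\<exists>w. admissible ?\<Delta> w)"
    by (metis admissible_val_codes admissible_of_codes val_codes_decode)
  moreover have "(\<exists>t<2 ^ N. admissible_codes N F a b (set_decode t) \<and>
        form_code A \<in> set_decode t \<and> form_code B \<notin> set_decode t) \<longleftrightarrow>
      (\<exists>w. admissible ?\<Delta> w \<and> val w A \<and> \<not> val w B)" (is "?L \<longleftrightarrow> ?R")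
    if "form_code A < N" "form_code B < N" for A B
  proof
    assume ?L
    then obtain t where t: "admissible_codes N F a b (set_decode t)"
        "form_code A \<in> set_decode t" "form_code B \<notin> set_decode t" by blast
    have T: "truth_set N F (set_decode t)" using t by (simp add: admissible_codes_def)
    show ?R using admissible_of_codes[OF t(1)] t(2,3) truth_set_val[OF F T] that by blast
  next
    assume ?R
    then obtain w where w: "admissible ?\<Delta> w" "val w A" "\<not> val w B" by blast
    obtain t where "t < 2 ^ N" "set_decode t = val_codes N w" by (rule val_codes_decode)
    then show ?L using admissible_val_codes[OF w(1)] w(2,3) mem_val_codes that by metis
  qed
  ultimately have "satisfiable_codes N F a b \<longleftrightarrow> (\<exists>w. admissible ?\<Delta> w) \<and>
     (\<forall>A B. StrictNonimp A B \<in> ?\<Delta> \<longrightarrow> (\<exists>w. admissible ?\<Delta> w \<and> val w A \<and> \<not> val w B))"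
    \<comment> \<open>Numbers related by \<open>nonimp_codes\<close> are formula codes, and
      components of nonimplications lie below \<open>N\<close>, so the bounded quantifiers over
      numbers match those over formulas.\<close>
    unfolding satisfiable_codes_def
    by (smt (verit, ccfv_threshold) imp_codes_form nonimp_codes_iff sform_code_less)
  then show ?thesis by (simp only: satisfiable_iff_admissible)
qed

end

lemma valid_code_iff:
  "valid_code n \<longleftrightarrow> n \<in> sequent_code ` {(\<Gamma>, \<phi>). finite \<Gamma> \<and> strict_consequence \<Gamma> \<phi>}"
proof
  assume "valid_code n"
  then obtain a b f where n: "n = prod_encode (a, b)" and ab: "a < Suc n" "b < Suc n"
    and f: "form_codes_upto (Suc n) (set_decode f)" and fb: "is_sform_code (set_decode f) b"
    and fa: "\<And>c. c < Suc n \<Longrightarrow> c \<in> set_decode a \<Longrightarrow> is_sform_code (set_decode f) c"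
    and unsat: "\<not> satisfiable_codes (Suc n) (set_decode f) a b"
    unfolding valid_code_def by blast
  obtain \<phi> where \<phi>: "b = sform_code \<phi>" using fb is_sform_code_iff[OF f ab(2)] by blast
  \<comment> \<open>The check covers only \<open>c < Suc n\<close>, but members of
    \<open>set_decode a\<close> are below \<open>a\<close>, so none is missed.\<close>
  have "set_decode a \<subseteq> range sform_code"
    using fa is_sform_code_iff[OF f] mem_set_decode_less ab(1) by (meson less_trans subsetI)
  then obtain \<Gamma> where \<Gamma>: "set_decode a = sform_code ` \<Gamma>" by (meson subset_imageE)
  have "inj sform_code" by (simp add: inj_def)
  then have "finite \<Gamma>"
    using \<Gamma> finite_set_decode[of a] by (metis finite_imageD inj_on_subset subset_UNIV)
  moreover have "strict_consequence \<Gamma> \<phi>"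
    using unsat satisfiable_codes_iff[OF f \<Gamma> \<phi> ab] strict_consequence_iff_unsat by blast
  moreover have "n = sequent_code (\<Gamma>, \<phi>)"
    \<comment> \<open>Read backwards, the equation for \<open>\<Gamma>\<close> turns the theory code
      into \<open>set_encode (set_decode a)\<close>, which is \<open>a\<close>.\<close>
    using n \<phi> \<Gamma>[symmetric] by (simp add: stheory_code_def)
  ultimately show "n \<in> sequent_code ` {(\<Gamma>, \<phi>). finite \<Gamma> \<and> strict_consequence \<Gamma> \<phi>}" by blast
next
  assume "n \<in> sequent_code ` {(\<Gamma>, \<phi>). finite \<Gamma> \<and> strict_consequence \<Gamma> \<phi>}"
  then obtain \<Gamma> \<phi> where fin: "finite \<Gamma>" and cons: "strict_consequence \<Gamma> \<phi>"
    and n: "n = prod_encode (stheory_code \<Gamma>, sform_code \<phi>)" by auto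
  define a b where "a = stheory_code \<Gamma>" and b: "b = sform_code \<phi>"
  then have \<Gamma>: "set_decode a = sform_code ` \<Gamma>" using fin by (simp add: stheory_code_def)
  have nab: "n = prod_encode (a, b)" using n a_def b by simp
  then have ab: "a < Suc n" "b < Suc n"
    by (simp_all add: le_prod_encode_1 le_prod_encode_2 less_Suc_eq_le)
  \<comment> \<open>The guess is the genuine set of formula codes, cut off after \<open>n\<close> to
    make it finite and its index small enough.\<close>
  define f where "f = set_encode (range form_code \<inter> {..<Suc n})"
  have f: "form_codes_upto (Suc n) (set_decode f)"
    using form_codes_upto_range by (simp add: f_def del: lessThan_Suc)
  moreover have "f < 2 ^ Suc n"
    unfolding f_def by (rule set_encode_less_power2) simp
  moreover have "is_sform_code (set_decode f) b" using is_sform_code_iff[OF f ab(2)] b by blast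
  moreover have "is_sform_code (set_decode f) c" if "c < Suc n" "c \<in> set_decode a" for c
    using is_sform_code_iff[OF f that(1)] that(2) \<Gamma> by blast
  moreover have "\<not> satisfiable_codes (Suc n) (set_decode f) a b"
    using satisfiable_codes_iff[OF f \<Gamma> b ab] cons strict_consequence_iff_unsat by blast
  ultimately show "valid_code n" unfolding valid_code_def using nab ab by blast
qed

theorem theorem14:
  "computable_set (sequent_code ` {(\<Gamma>, \<phi>). finite \<Gamma> \<and> strict_consequence \<Gamma> \<phi>})"
proof -
  obtain f where f: "\<And>e. computes f (map e [0..<Suc 0]) (if valid_code (e 0) then 1 else 0)"
    using decidable_valid_code unfolding decidable_def computable_def by blast
  have "computes f [n] (if valid_code n then 1 else 0)" for n
    using f[of "\<lambda>_. n"] by simp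
  then show ?thesis unfolding computable_set_def valid_code_iff by blast
qed

end
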